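(* Let $p$ be a prime, let $n,r\ge 1$, and let $g_1,\dots,g_r\in\mathbb{Z}[x_1,\dots,x_n]$ be polynomials with all coefficients in $\{0,1,\dots,p-1\}$. Let $h_1,\dots,h_r\in\mathbb{Z}[x_1,\dots,x_n]$, and for each $i$ let $\tilde g_i$ be the image of $g_i+p h_i$ in $(\mathbb{Z}/p^2)[x_1,\dots,x_n]$. Let $I\subseteq\mathbb{F}_p[x_1,\dots,x_n]$ be the ideal generated by the reductions modulo $p$ of $g_1,\dots,g_r$, let $A=\mathbb{F}_p[x_1,\dots,x_n]/I$, let $\tilde I=(\tilde g_1,\dots,\tilde g_r)\subseteq(\mathbb{Z}/p^2)[x_1,\dots,x_n]$, and let $B=(\mathbb{Z}/p^2)[x_1,\dots,x_n]/\tilde I$. Assume that $B$ is flat over $\mathbb{Z}/p^2$. Let $x_1',\dots,x_n'\in\mathbb{Z}[x_1,\dots,x_n]$, and let $\varphi\colon(\mathbb{Z}/p^2)[x_1,\dots,x_n]\to(\mathbb{Z}/p^2)[x_1,\dots,x_n]$ be the ring homomorphism with $\varphi(x_j)=x_j^p+p\,x_j'$ for $1\le j\le n$. Then $\varphi(\tilde I)\subseteq\tilde I$ (equivalently, $\varphi$ induces a well-defined ring homomorphism $B\to B$, which is then a lift of the Frobenius of $A$) if and only if for every $i\in\{1,\dots,r\}$ the reduction modulo $p$ of $$\delta(g_i)+h_i^p+\sum_{j=1}^n\frac{\partial g_i}{\partial x_j}(x_1^p,\dots,x_n^p)\cdot x_j'$$ lies in $I$.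
   Context: For $g\in\mathbb{Z}[x_1,\dots,x_n]$, set $$\delta(g)=\frac{g(x_1^p,\dots,x_n^p)-g(x_1,\dots,x_n)^p}{p}\in\mathbb{Z}[x_1,\dots,x_n];$$ this has integer coefficients because the numerator is divisible by $p$. A lift of the Frobenius of $A$ to $B$ is a ring homomorphism $\psi\colon B\to B$ such that for every $b\in B$ one has $\psi(b)=b^p+pb'$ for some $b'\in B$. Note that $B/pB=A$. *)

theory Defs
  imports
    "Berlekamp_Zassenhaus.Finite_Field"
    "HOL-Library.Poly_Mapping"
    "HOL-Algebra.QuotRing"
    "HOL-Algebra.Module"
    "HOL-Algebra.Generated_Groups"
    "HOL-Algebra.Free_Abelian_Groups"
    "HOL-Algebra.Algebraic_Closure_Type"
begin

section \<open>Polynomials in finitely many variables\<close>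

text \<open>
  A polynomial with variables indexed by \<^typ>\<open>'n\<close> is a finitely supported function from
  exponent vectors to coefficients.  For \<^typ>\<open>'n\<close> of class \<^class>\<open>finite\<close> the number of
  variables is \<open>CARD('n)\<close>, and the ring operations are those of \<^theory>\<open>HOL-Library.Poly_Mapping\<close>.
\<close>

type_synonym ('n, 'a) mpoly = "('n \<Rightarrow>\<^sub>0 nat) \<Rightarrow>\<^sub>0 'a"

definition Const :: "'a::zero \<Rightarrow> ('n, 'a) mpoly"
  where "Const c = Poly_Mapping.single 0 c"

definition Var :: "'n \<Rightarrow> ('n, 'a::zero_neq_one) mpoly"
  where "Var j = Poly_Mapping.single (Poly_Mapping.single j 1) 1"

definition mpoly_subst ::
    "('n::finite \<Rightarrow> ('k, 'a::comm_ring_1) mpoly) \<Rightarrow> ('n, 'a) mpoly \<Rightarrow> ('k, 'a) mpoly"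
  where "mpoly_subst \<sigma> f =
    (\<Sum>m\<in>Poly_Mapping.keys f.
       Const (Poly_Mapping.lookup f m) * (\<Prod>j\<in>UNIV. \<sigma> j ^ Poly_Mapping.lookup m j))"

text \<open>
  The truncated subtraction of exponents below is harmless: if \<open>x\<^sub>j\<close> does not occur in the
  monomial \<open>m\<close>, the coefficient is \<open>0\<close>.
\<close>

definition mpoly_pderiv :: "'n \<Rightarrow> ('n, 'a::comm_ring_1) mpoly \<Rightarrow> ('n, 'a) mpoly"
  where "mpoly_pderiv j f =
    (\<Sum>m\<in>Poly_Mapping.keys f.
       Poly_Mapping.single (m - Poly_Mapping.single j 1)
         (of_nat (Poly_Mapping.lookup m j) * Poly_Mapping.lookup f m))"

definition mpoly_reduce :: "('n, int) mpoly \<Rightarrow> ('n, 'a::comm_ring_1) mpoly"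
  where "mpoly_reduce f = Poly_Mapping.map of_int f"

text \<open>
  For prime \<open>p\<close> all coefficients of \<open>g(x\<^sub>1\<^sup>p, \<dots>, x\<^sub>n\<^sup>p) - g\<^sup>p\<close> are divisible by \<open>p\<close>, so the
  coefficientwise integer division is exact.
\<close>

definition delta :: "nat \<Rightarrow> ('n::finite, int) mpoly \<Rightarrow> ('n, int) mpoly"
  where "delta p g =
    Poly_Mapping.map (\<lambda>c. c div int p) (mpoly_subst (\<lambda>j. Var j ^ p) g - g ^ p)"


section \<open>Tensor products and flatness\<close>

definition module_homs :: "('a, 'm) ring_scheme \<Rightarrow> ('a, 'b) module \<Rightarrow> ('a, 'c) module \<Rightarrow> ('b \<Rightarrow> 'c) set"
  where "module_homs R M N =
    {f \<in> carrier M \<rightarrow> carrier N.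
       (\<forall>x\<in>carrier M. \<forall>y\<in>carrier M. f (x \<oplus>\<^bsub>M\<^esub> y) = f x \<oplus>\<^bsub>N\<^esub> f y) \<and>
       (\<forall>a\<in>carrier R. \<forall>x\<in>carrier M. f (a \<odot>\<^bsub>M\<^esub> x) = a \<odot>\<^bsub>N\<^esub> f x)}"

definition tensor_relators ::
    "('a, 'm) ring_scheme \<Rightarrow> ('a, 'b) module \<Rightarrow> ('a, 'c) module \<Rightarrow> ('b \<times> 'c \<Rightarrow>\<^sub>0 int) set"
  where "tensor_relators R M N =
    {frag_of (x \<oplus>\<^bsub>M\<^esub> y, z) - frag_of (x, z) - frag_of (y, z) |x y z.
       x \<in> carrier M \<and> y \<in> carrier M \<and> z \<in> carrier N} \<union>
    {frag_of (x, z \<oplus>\<^bsub>N\<^esub> w) - frag_of (x, z) - frag_of (x, w) |x z w.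
       x \<in> carrier M \<and> z \<in> carrier N \<and> w \<in> carrier N} \<union>
    {frag_of (a \<odot>\<^bsub>M\<^esub> x, z) - frag_of (x, a \<odot>\<^bsub>N\<^esub> z) |a x z.
       a \<in> carrier R \<and> x \<in> carrier M \<and> z \<in> carrier N}"

definition tensor_kernel ::
    "('a, 'm) ring_scheme \<Rightarrow> ('a, 'b) module \<Rightarrow> ('a, 'c) module \<Rightarrow> ('b \<times> 'c \<Rightarrow>\<^sub>0 int) set"
  where "tensor_kernel R M N =
    generate (free_Abelian_group (carrier M \<times> carrier N)) (tensor_relators R M N)"

definition tensor_product ::
    "('a, 'm) ring_scheme \<Rightarrow> ('a, 'b) module \<Rightarrow> ('a, 'c) module \<Rightarrow> ('b \<times> 'c \<Rightarrow>\<^sub>0 int) set monoid"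
  where "tensor_product R M N =
    free_Abelian_group (carrier M \<times> carrier N) Mod tensor_kernel R M N"

text \<open>For a homomorphism \<open>f\<close> from \<open>M\<close> to \<open>M'\<close>, this is the induced map from
  \<open>M \<otimes> N\<close> to \<open>M' \<otimes> N\<close>.\<close>

definition tensor_map ::
    "('a, 'm) ring_scheme \<Rightarrow> ('a, 'd) module \<Rightarrow> ('a, 'c) module \<Rightarrow> ('b \<Rightarrow> 'd) \<Rightarrow>
      ('b \<times> 'c \<Rightarrow>\<^sub>0 int) set \<Rightarrow> ('d \<times> 'c \<Rightarrow>\<^sub>0 int) set"
  where "tensor_map R M' N f T =
    the_elem
      ((\<lambda>t. r_coset (free_Abelian_group (carrier M' \<times> carrier N)) (tensor_kernel R M' N)
              (frag_extend (\<lambda>(x, z). frag_of (f x, z)) t)) ` T)"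

text \<open>
  \<open>N\<close> is flat if tensoring with \<open>N\<close> preserves injectivity.  A definition cannot quantify over
  types, so the test modules live on \<^typ>\<open>'a list set\<close>.  This loses nothing: every finitely
  generated \<open>R\<close>-module is a quotient of some \<open>R\<^sup>k\<close>, hence isomorphic to a module whose elements
  are sets of lists over \<open>R\<close>, and the inclusions of finitely generated ideals into \<open>R\<close> already
  suffice to test flatness.
\<close>

definition flat_module :: "('a, 'm) ring_scheme \<Rightarrow> ('a, 'c) module \<Rightarrow> bool"
  where "flat_module R N \<longleftrightarrow>
    Module.module R N \<and>
    (\<forall>(M :: ('a, 'a list set) module) (M' :: ('a, 'a list set) module) f.
       Module.module R M \<longrightarrow> Module.module R M' \<longrightarrow>
       f \<in> module_homs R M M' \<longrightarrow> inj_on f (carrier M) \<longrightarrow>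
       inj_on (tensor_map R M' N f) (carrier (tensor_product R M N)))"


section \<open>Restriction of scalars, and lifts of the Frobenius\<close>

text \<open>The ring \<open>B\<close> as a module over the source of the ring homomorphism \<open>\<iota>\<close> into \<open>B\<close>.\<close>

definition module_via :: "('a \<Rightarrow> 'b) \<Rightarrow> 'b ring \<Rightarrow> ('a, 'b) module"
  where "module_via \<iota> B =
    \<lparr>carrier = carrier B, monoid.mult = monoid.mult B, monoid.one = monoid.one B, ring.zero = ring.zero B, ring.add = ring.add B,
     module.smult = (\<lambda>a b. \<iota> a \<otimes>\<^bsub>B\<^esub> b)\<rparr>"

definition frobenius_lift :: "nat \<Rightarrow> ('b, 'm) ring_scheme \<Rightarrow> ('b \<Rightarrow> 'b) \<Rightarrow> bool"
  where "frobenius_lift p B \<psi> \<longleftrightarrow>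
    \<psi> \<in> Ring.ring_hom B B \<and>
    (\<forall>b\<in>carrier B. \<exists>b'\<in>carrier B. \<psi> b = b [^]\<^bsub>B\<^esub> p \<oplus>\<^bsub>B\<^esub> [p] \<cdot>\<^bsub>B\<^esub> b')"

end

theory Submission
  imports Defs
begin

text \<open>
  Because \<open>p\<^sup>2 = 0\<close>, Taylor expansion gives \<open>\<phi>(f) = f\<^sup>p + p (\<delta>(f) + D f)\<close> for
  every integral \<open>f\<close>, where \<open>D f\<close> is the sum of the \<open>(\<partial>f/\<partial>x\<^sub>j)(x\<^sup>p) x'\<^sub>j\<close>.  For
  \<open>f = g + p h\<close> one has \<open>f\<^sup>p = g\<^sup>p\<close> and \<open>p \<phi>(h) = p h\<^sup>p\<close>, so \<open>\<phi>(f) = f\<^sup>p + p E\<close> with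
  \<open>E = \<delta>(g) + h\<^sup>p + D g\<close>, and \<open>\<phi>\<close> preserves the ideal iff all the \<open>p E\<close> lie in it.  Flatness says
  that the \<open>p\<close>-torsion of \<open>B\<close> is \<open>p B\<close>, hence \<open>p E\<close> vanishes in \<open>B\<close> iff \<open>E\<close> vanishes in
  \<open>B / p B = A\<close>.
\<close>

section \<open>Polynomials in finitely many variables\<close>

text \<open>A finitely supported function is the sum of its monomials. With this rule an additive
  identity needs checking on \<open>Poly_Mapping.single\<close> only.\<close>

lemma poly_mapping_add_induct [case_names zero single add]:
  assumes "P 0" and "\<And>m c. P (Poly_Mapping.single m c)"
    and "\<And>f g. P f \<Longrightarrow> P g \<Longrightarrow> P (f + g)"
  shows "P (f :: 'k \<Rightarrow>\<^sub>0 'a::comm_monoid_add)"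
proof -
  have "f = (\<Sum>m\<in>Poly_Mapping.keys f. Poly_Mapping.single m (Poly_Mapping.lookup f m))"
    by (rule poly_mapping_eqI)
      (simp add: lookup_sum lookup_single when_def not_in_keys_iff_lookup_eq_zero)
  moreover have "P (\<Sum>m\<in>A. Poly_Mapping.single m (Poly_Mapping.lookup f m))" if "finite A" for A
    using that by induction (auto intro: assms)
  ultimately show ?thesis
    by (metis finite_keys)
qed

text \<open>Both sides are additive in each factor, so pairs of monomials suffice. This yields
  multiplicativity of coefficient reduction and of substitution.\<close>

lemma additive_multiplicativeI:
  fixes F :: "('k::comm_monoid_add \<Rightarrow>\<^sub>0 'a::comm_semiring_1) \<Rightarrow> 'b::comm_ring_1"
  assumes add: "\<And>f g. F (f + g) = F f + F g"
    and single: "\<And>m n a b. F (Poly_Mapping.single m a * Poly_Mapping.single n b)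
      = F (Poly_Mapping.single m a) * F (Poly_Mapping.single n b)"
  shows "F (f * g) = F f * F g"
proof -
  have zero: "F 0 = 0"
    using add[of 0 0] by simp
  have "F (Poly_Mapping.single m a * g) = F (Poly_Mapping.single m a) * F g" for m a
    by (induction g rule: poly_mapping_add_induct) (simp_all add: zero single add distrib_left)
  then show ?thesis
    by (induction f rule: poly_mapping_add_induct) (simp_all add: zero add distrib_right)
qed

lemma single_eq_Const_mult_prod_Var:
  "Poly_Mapping.single m (c :: 'a::comm_ring_1) = Const c * (\<Prod>j\<in>(UNIV::'n::finite set). Var j ^ Poly_Mapping.lookup m j)"
proof -
  have pow: "Var j ^ k = Poly_Mapping.single (Poly_Mapping.single j k) (1::'a)" for j :: 'n and k
    by (induction k) (simp_all add: Var_def mult_single single_add[symmetric])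
  have "(\<Prod>j\<in>A. Poly_Mapping.single (Poly_Mapping.single j (Poly_Mapping.lookup m j)) (1::'a))
      = Poly_Mapping.single (\<Sum>j\<in>A. Poly_Mapping.single j (Poly_Mapping.lookup m j)) 1" if "finite A" for A
    using that by induction (simp_all add: mult_single)
  moreover have "(\<Sum>j\<in>UNIV. Poly_Mapping.single j (Poly_Mapping.lookup m j)) = m"
    by (rule poly_mapping_eqI) (simp add: lookup_sum lookup_single when_def)
  ultimately show ?thesis
    by (simp add: pow Const_def mult_single)
qed

text \<open>Constants and variables generate the polynomial ring. The Frobenius congruence and the
  Taylor expansion below are both stable under sums and products, which makes this the fitting
  induction.\<close>

lemma mpoly_induct [case_names Const Var add mult]:
  fixes f :: "('n::finite, 'a::comm_ring_1) mpoly"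
  assumes "\<And>c. P (Const c)" "\<And>j. P (Var j)"
    and add: "\<And>f g. P f \<Longrightarrow> P g \<Longrightarrow> P (f + g)"
    and mult: "\<And>f g. P f \<Longrightarrow> P g \<Longrightarrow> P (f * g)"
  shows "P f"
proof -
  have one: "P 1"
    using assms(1)[of 1] by (simp add: Const_def)
  have pow: "P (Var j ^ k)" for j k
    by (induction k) (simp_all add: one mult assms(2))
  have "P (\<Prod>j\<in>A. Var j ^ Poly_Mapping.lookup m j)" if "finite A" for A m
    using that by induction (simp_all add: one mult pow)
  then have "P (Poly_Mapping.single m c)" for m c
    by (simp add: single_eq_Const_mult_prod_Var mult assms(1))
  then show ?thesis
    using assms(1)[of 0] by (induction f rule: poly_mapping_add_induct) (simp_all add: Const_def add)
qed

lemma Const_add: "Const (a + b) = (Const a + Const b :: ('n, 'a::comm_ring_1) mpoly)"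
  by (simp add: Const_def single_add)

lemma Const_mult: "Const (a * b) = (Const a * Const b :: ('n, 'a::comm_ring_1) mpoly)"
  by (simp add: Const_def mult_single)

lemma Const_of_int: "Const (of_int c :: 'a::comm_ring_1) = of_int c"
  by (simp add: Const_def)

lemma lookup_of_nat_mult:
  "Poly_Mapping.lookup (of_nat k * f) m = of_nat k * Poly_Mapping.lookup (f :: ('n, 'a::comm_ring_1) mpoly) m"
  by (induction k) (simp_all add: lookup_add distrib_right)

subsection \<open>Reduction of the coefficients\<close>

lemma lookup_mpoly_reduce [simp]:
  "Poly_Mapping.lookup (mpoly_reduce f) m = of_int (Poly_Mapping.lookup f m)"
  by (simp add: mpoly_reduce_def map.rep_eq when_def)

lemma mpoly_reduce_add: "mpoly_reduce (f + g) = mpoly_reduce f + mpoly_reduce g"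
  by (rule poly_mapping_eqI) (simp add: lookup_add)

lemma mpoly_reduce_single [simp]:
  "mpoly_reduce (Poly_Mapping.single m c) = Poly_Mapping.single m (of_int c)"
  by (rule poly_mapping_eqI) (simp add: lookup_single when_def)

lemma mpoly_reduce_mult: "mpoly_reduce (f * g) = mpoly_reduce f * mpoly_reduce g"
  by (rule additive_multiplicativeI) (simp_all add: mpoly_reduce_add mult_single)

lemma mpoly_reduce_0 [simp]: "mpoly_reduce 0 = 0"
  by (rule poly_mapping_eqI) simp

lemma mpoly_reduce_1 [simp]: "mpoly_reduce 1 = 1"
  using mpoly_reduce_single[of 0 1] by simp

lemma mpoly_reduce_Const [simp]: "mpoly_reduce (Const c) = of_int c"
  by (simp add: Const_def)

lemma mpoly_reduce_Var [simp]: "mpoly_reduce (Var j) = Var j"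
  by (simp add: Var_def)

lemma mpoly_reduce_of_nat [simp]: "mpoly_reduce (of_nat k) = of_nat k"
  by (induction k) (simp_all add: mpoly_reduce_add)

lemma mpoly_reduce_diff: "mpoly_reduce (f - g) = mpoly_reduce f - mpoly_reduce g"
  by (rule poly_mapping_eqI) (simp add: lookup_minus)

lemma mpoly_reduce_power: "mpoly_reduce (f ^ k) = mpoly_reduce f ^ k"
  by (induction k) (simp_all add: mpoly_reduce_mult)

lemmas mpoly_reduce_hom = mpoly_reduce_add mpoly_reduce_mult mpoly_reduce_diff mpoly_reduce_power

text \<open>Integral representatives mediate between the coefficient rings Z/p and Z/p^2, which are
  separate types here.\<close>

lemma mpoly_reduce_surj: "\<exists>F. mpoly_reduce F = (f :: ('n, 'q::nontriv mod_ring) mpoly)"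
proof
  show "mpoly_reduce (Poly_Mapping.map to_int_mod_ring f) = f"
    by (rule poly_mapping_eqI) (simp add: map.rep_eq when_def of_int_of_int_mod_ring)
qed

lemma of_int_mod_ring_eq_0_iff: "(of_int c :: 'q::nontriv mod_ring) = 0 \<longleftrightarrow> int CARD('q) dvd c"
  unfolding of_int_of_int_mod_ring by transfer (simp add: dvd_eq_mod_eq_0)

lemma mpoly_reduce_eq_0_iff:
  "mpoly_reduce f = (0 :: ('n, 'q::nontriv mod_ring) mpoly) \<longleftrightarrow> (\<forall>m. int CARD('q) dvd Poly_Mapping.lookup f m)"
  by (simp add: poly_mapping_eq_iff fun_eq_iff of_int_mod_ring_eq_0_iff)

subsection \<open>Substitution and partial derivatives\<close>

lemma mpoly_subst_add: "mpoly_subst \<sigma> (f + g) = mpoly_subst \<sigma> f + mpoly_subst \<sigma> g"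
  unfolding mpoly_subst_def
  \<comment> \<open>Terms may cancel, so the keys of a sum need not be the union of the keys. The
    rule only asks that the summand be additive in the coefficient and vanish at coefficient
    0.\<close>
  by (rule setsum_keys_plus_distrib) (simp_all add: Const_def single_add distrib_right)

lemma mpoly_subst_single:
  "mpoly_subst \<sigma> (Poly_Mapping.single m c) = Const c * (\<Prod>j\<in>UNIV. \<sigma> j ^ Poly_Mapping.lookup m j)"
  by (cases "c = 0") (simp_all add: mpoly_subst_def Const_def)

lemma mpoly_subst_mult: "mpoly_subst \<sigma> (f * g) = mpoly_subst \<sigma> f * mpoly_subst \<sigma> g"
  by (rule additive_multiplicativeI)
    (simp_all add: mpoly_subst_add mult_single mpoly_subst_single Const_mult lookup_add power_add
      prod.distrib mult_ac)

lemma mpoly_subst_Const [simp]: "mpoly_subst \<sigma> (Const c) = Const c"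
  by (simp add: Const_def mpoly_subst_single)

lemma mpoly_subst_0 [simp]: "mpoly_subst \<sigma> 0 = 0"
  using mpoly_subst_Const[of \<sigma> 0] by (simp add: Const_def)

lemma mpoly_subst_1 [simp]: "mpoly_subst \<sigma> 1 = 1"
  using mpoly_subst_Const[of \<sigma> 1] by (simp add: Const_def)

lemma mpoly_subst_of_int [simp]: "mpoly_subst \<sigma> (of_int c) = of_int c"
  using mpoly_subst_Const[of \<sigma> "of_int c"] by (simp only: Const_of_int)

lemma mpoly_subst_Var [simp]: "mpoly_subst \<sigma> (Var j) = \<sigma> j"
proof -
  have "(\<Prod>k\<in>UNIV. \<sigma> k ^ Poly_Mapping.lookup (Poly_Mapping.single j 1) k) = (\<Prod>k\<in>UNIV. if k = j then \<sigma> k else 1)"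
    by (rule prod.cong) (simp_all add: lookup_single when_def)
  then show ?thesis
    by (simp add: Var_def mpoly_subst_single Const_def)
qed

lemma mpoly_pderiv_add: "mpoly_pderiv j (f + g) = mpoly_pderiv j f + mpoly_pderiv j g"
  unfolding mpoly_pderiv_def
  by (rule setsum_keys_plus_distrib) (simp_all add: single_add distrib_left)

lemma mpoly_pderiv_single:
  "mpoly_pderiv j (Poly_Mapping.single m c)
    = Poly_Mapping.single (m - Poly_Mapping.single j 1) (of_nat (Poly_Mapping.lookup m j) * c)"
  by (cases "c = 0") (simp_all add: mpoly_pderiv_def)

lemma mpoly_pderiv_0 [simp]: "mpoly_pderiv j 0 = 0"
  by (simp add: mpoly_pderiv_def)

lemma mpoly_pderiv_Const [simp]: "mpoly_pderiv j (Const c) = 0"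
  by (simp add: Const_def mpoly_pderiv_single)

lemma mpoly_pderiv_Var: "mpoly_pderiv j (Var k) = (if j = k then 1 else 0)"
  by (simp add: Var_def mpoly_pderiv_single lookup_single when_def)

lemma mpoly_pderiv_mult:
  fixes f g :: "('n, 'a::comm_ring_1) mpoly"
  shows "mpoly_pderiv j (f * g) = mpoly_pderiv j f * g + f * mpoly_pderiv j g"
proof -
  \<comment> \<open>The exponent subtraction is truncated: it commutes with adding \<open>n\<close>
    when \<open>j\<close> occurs in \<open>m\<close>, and otherwise both coefficients are 0.\<close>
  have shift: "Poly_Mapping.single (m + n - Poly_Mapping.single j 1) (of_nat (Poly_Mapping.lookup m j) * c)
      = Poly_Mapping.single (m - Poly_Mapping.single j 1 + n) (of_nat (Poly_Mapping.lookup m j) * c)"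
    for m n :: "'n \<Rightarrow>\<^sub>0 nat" and c :: 'a
  proof (cases "Poly_Mapping.lookup m j = 0")
    case False
    then have "m + n - Poly_Mapping.single j 1 = m - Poly_Mapping.single j 1 + n"
      by (intro poly_mapping_eqI) (auto simp: lookup_add lookup_minus lookup_single when_def)
    then show ?thesis by simp
  qed simp
  have "mpoly_pderiv j (Poly_Mapping.single m a * Poly_Mapping.single n b)
      = mpoly_pderiv j (Poly_Mapping.single m a) * Poly_Mapping.single n b
        + Poly_Mapping.single m a * mpoly_pderiv j (Poly_Mapping.single n b)" for m n and a b :: 'a
  proof -
    have "mpoly_pderiv j (Poly_Mapping.single m a * Poly_Mapping.single n b)
        = Poly_Mapping.single (m + n - Poly_Mapping.single j 1) (of_nat (Poly_Mapping.lookup m j) * (a * b))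
          + Poly_Mapping.single (n + m - Poly_Mapping.single j 1) (of_nat (Poly_Mapping.lookup n j) * (a * b))"
      by (simp add: mult_single mpoly_pderiv_single lookup_add distrib_right single_add add.commute)
    also have "\<dots> = Poly_Mapping.single (m - Poly_Mapping.single j 1 + n) (of_nat (Poly_Mapping.lookup m j) * (a * b))
          + Poly_Mapping.single (n - Poly_Mapping.single j 1 + m) (of_nat (Poly_Mapping.lookup n j) * (a * b))"
      by (simp only: shift)
    finally show ?thesis
      by (simp add: mult_single mpoly_pderiv_single mult_ac add.commute)
  qed
  then have "mpoly_pderiv j (Poly_Mapping.single m a * g)
      = mpoly_pderiv j (Poly_Mapping.single m a) * g + Poly_Mapping.single m a * mpoly_pderiv j g" for m a
    by (induction g rule: poly_mapping_add_induct) (simp_all add: mpoly_pderiv_add algebra_simps)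
  then show ?thesis
    by (induction f rule: poly_mapping_add_induct) (simp_all add: mpoly_pderiv_add algebra_simps)
qed

section \<open>Congruences for the Frobenius\<close>

text \<open>All binomial coefficients other than the two outer ones are divisible by the
  prime.\<close>

lemma prime_dvd_power_add_diff:
  fixes a b :: "'a::comm_ring_1"
  assumes "Factorial_Ring.prime (p :: nat)"
  shows "of_nat p dvd (a + b) ^ p - (a ^ p + b ^ p)"
proof -
  have p: "p > 0"
    using assms by (rule prime_gt_0_nat)
  let ?t = "\<lambda>k. of_nat (p choose k) * a ^ k * b ^ (p - k)"
  have "(a + b) ^ p = (\<Sum>k\<in>{..p}. ?t k)"
    by (rule binomial_ring)
  also have "{..p} = insert 0 (insert p {0<..<p})"
    using p by auto
  also have "(\<Sum>k\<in>insert 0 (insert p {0<..<p}). ?t k) = b ^ p + (a ^ p + (\<Sum>k\<in>{0<..<p}. ?t k))"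
    using p by simp
  finally have "(a + b) ^ p - (a ^ p + b ^ p) = (\<Sum>k\<in>{0<..<p}. ?t k)"
    by simp
  moreover have "of_nat p dvd ?t k" if "k \<in> {0<..<p}" for k
  proof -
    have "p dvd p choose k"
      using that assms by (intro dvd_choose_prime) auto
    then obtain c where "p choose k = p * c" ..
    then have "?t k = of_nat p * (of_nat c * a ^ k * b ^ (p - k))"
      by (simp add: mult.assoc)
    then show ?thesis
      by (rule dvdI)
  qed
  ultimately show ?thesis
    by (simp only: dvd_sum)
qed

text \<open>Factor the difference of powers: one factor is \<open>of_nat p * b\<close>, the other
  has p terms, each congruent to \<open>a ^ (p - 1)\<close> modulo p, so it is divisible by p as
  well. Thus p-th powers modulo p^2 depend only on the base modulo p.\<close>

lemma dvd_power_diff_power_square: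
  fixes a b :: "'a::comm_ring_1"
  shows "of_nat p ^ 2 dvd (a + of_nat p * b) ^ p - a ^ p"
proof -
  let ?x = "a + of_nat p * b"
  have pow: "of_nat p dvd ?x ^ k - a ^ k" for k
  proof -
    have "?x ^ k - a ^ k = (?x - a) * (\<Sum>i<k. a ^ (k - Suc i) * ?x ^ i)"
      by (rule power_diff_sumr2)
    then show ?thesis by simp
  qed
  have "of_nat p dvd (\<Sum>i<p. a ^ (p - Suc i) * (?x ^ i - a ^ i))"
    using pow by (intro dvd_sum) simp
  moreover have "(\<Sum>i<p. a ^ (p - Suc i) * a ^ i) = of_nat p * a ^ (p - 1)"
  proof -
    have "(\<Sum>i<p. a ^ (p - Suc i) * a ^ i) = (\<Sum>i<p. a ^ (p - 1))"
      by (rule sum.cong) (simp_all add: power_add[symmetric])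
    then show ?thesis by simp
  qed
  ultimately have "of_nat p dvd (\<Sum>i<p. a ^ (p - Suc i) * (?x ^ i - a ^ i)) + (\<Sum>i<p. a ^ (p - Suc i) * a ^ i)"
    by simp
  then have "of_nat p dvd (\<Sum>i<p. a ^ (p - Suc i) * ?x ^ i)"
    by (simp add: right_diff_distrib sum_subtractf)
  then have "of_nat p * of_nat p dvd (of_nat p * b) * (\<Sum>i<p. a ^ (p - Suc i) * ?x ^ i)"
    by (intro mult_dvd_mono) simp_all
  moreover have "?x ^ p - a ^ p = (?x - a) * (\<Sum>i<p. a ^ (p - Suc i) * ?x ^ i)"
    by (rule power_diff_sumr2)
  ultimately show ?thesis
    by (simp add: power2_eq_square)
qed

lemma of_nat_dvd_mpoly_subst_diff_power:
  fixes f :: "('n::finite, int) mpoly"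
  assumes "Factorial_Ring.prime p"
  shows "of_nat p dvd mpoly_subst (\<lambda>k. Var k ^ p) f - f ^ p"
proof (induction f rule: mpoly_induct)
  case (Const c)
  have "int p dvd c - c ^ p"
  proof -
    \<comment> \<open>Fermat's little theorem: induction on naturals first, then any integer is
      replaced by its residue, which is nonnegative.\<close>
    have nat: "int p dvd int n - int n ^ p" for n
    proof (induction n)
      case 0
      then show ?case using assms by (simp add: prime_gt_0_nat zero_power)
    next
      case (Suc n)
      have "int p dvd (int n + 1) ^ p - (int n ^ p + 1 ^ p)"
        using prime_dvd_power_add_diff[OF assms, of "int n" 1] by simp
      then have "int p dvd (int n - int n ^ p) - ((int n + 1) ^ p - (int n ^ p + 1 ^ p))"
        using Suc by (rule dvd_diff[rotated])
      then show ?case by (simp add: algebra_simps)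
    qed
    define n where "n = nat (c mod int p)"
    have n: "int n = c mod int p"
      using assms by (simp add: n_def prime_gt_0_nat)
    have "(c - c ^ p) mod int p = (int n - int n ^ p) mod int p"
      unfolding n by (rule mod_diff_cong) (simp_all add: power_mod)
    then show ?thesis
      using nat[of n] by (simp add: dvd_eq_mod_eq_0)
  qed
  then obtain d where "c - c ^ p = int p * d" ..
  then have "of_int c - of_int c ^ p = (of_nat p * of_int d :: ('n, int) mpoly)"
    by (metis of_int_diff of_int_mult of_int_of_nat_eq of_int_power)
  then show ?case
    by (simp add: Const_of_int[of c, where ?'a = int, simplified])
next
  case (Var j)
  then show ?case by simp
next
  case (add f g)
  have "of_nat p dvd (mpoly_subst (\<lambda>k. Var k ^ p) f - f ^ p) + (mpoly_subst (\<lambda>k. Var k ^ p) g - g ^ p)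
      - ((f + g) ^ p - (f ^ p + g ^ p))"
    by (rule dvd_diff[OF dvd_add[OF add] prime_dvd_power_add_diff[OF assms]])
  then show ?case
    by (simp add: mpoly_subst_add algebra_simps)
next
  case (mult f g)
  have "of_nat p dvd (mpoly_subst (\<lambda>k. Var k ^ p) f - f ^ p) * mpoly_subst (\<lambda>k. Var k ^ p) g
      + f ^ p * (mpoly_subst (\<lambda>k. Var k ^ p) g - g ^ p)"
    using mult by simp
  then show ?case
    by (simp add: mpoly_subst_mult power_mult_distrib algebra_simps)
qed

text \<open>By the preceding divisibility, the coefficientwise \<open>div\<close> is exact. Later
  arguments use \<open>delta\<close> only through this identity.\<close>

lemma of_nat_mult_delta:
  assumes "Factorial_Ring.prime p"
  shows "of_nat p * delta p f = mpoly_subst (\<lambda>k. Var k ^ p) f - f ^ p"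
proof (rule poly_mapping_eqI)
  fix m
  obtain e where "mpoly_subst (\<lambda>k. Var k ^ p) f - f ^ p = of_nat p * e"
    using of_nat_dvd_mpoly_subst_diff_power[OF assms, of f] unfolding dvd_def by blast
  then show "Poly_Mapping.lookup (of_nat p * delta p f) m
      = Poly_Mapping.lookup (mpoly_subst (\<lambda>k. Var k ^ p) f - f ^ p) m"
    using assms by (simp add: delta_def lookup_of_nat_mult map.rep_eq when_def prime_gt_0_nat)
qed

locale frobenius_perturbation =
  fixes p :: nat and x' :: "'n::finite \<Rightarrow> ('n, int) mpoly"
    and \<phi> :: "('n, 'q::nontriv mod_ring) mpoly \<Rightarrow> ('n, 'q mod_ring) mpoly"
  assumes prime_p: "Factorial_Ring.prime p" and card_q: "CARD('q) = p ^ 2"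
    and \<phi>_one: "\<phi> 1 = 1"
    and \<phi>_add: "\<phi> (f + g) = \<phi> f + \<phi> g"
    and \<phi>_mult: "\<phi> (f * g) = \<phi> f * \<phi> g"
    and \<phi>_Var: "\<phi> (Var j) = Var j ^ p + of_nat p * mpoly_reduce (x' j)"
begin

lemma of_nat_p_square: "of_nat p * (of_nat p * f) = (0 :: ('n, 'q mod_ring) mpoly)"
proof -
  have "of_nat p * of_nat p = (of_nat CARD('q) :: ('n, 'q mod_ring) mpoly)"
    by (simp add: card_q power2_eq_square)
  also have "\<dots> = Poly_Mapping.single 0 (of_nat CARD('q))"
    by (simp only: single_of_nat)
  also have "\<dots> = 0"
    by (simp only: of_nat_card_eq_0 single_zero)
  finally show ?thesis
    by (simp add: mult.assoc[symmetric])
qed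

lemma \<phi>_zero: "\<phi> 0 = 0"
  using \<phi>_add[of 0 0] by simp

lemma \<phi>_of_nat: "\<phi> (of_nat k) = of_nat k"
  by (induction k) (simp_all add: \<phi>_zero \<phi>_one \<phi>_add)

text \<open>Constants of Z/p^2 are images of integers, so any ring homomorphism fixes them; the
  values on variables then determine \<phi>.\<close>

lemma \<phi>_of_int: "\<phi> (of_int c) = of_int c"
proof (cases c rule: int_cases2)
  case (nonneg k)
  then show ?thesis by (simp add: \<phi>_of_nat)
next
  case (nonpos k)
  have "\<phi> (of_int c) + of_nat k = \<phi> (of_int c + of_nat k)"
    by (simp only: \<phi>_add \<phi>_of_nat)
  then have "\<phi> (of_int c) + of_nat k = 0"
    using nonpos by (simp add: \<phi>_zero)
  then show ?thesis
    using nonpos by (simp add: eq_neg_iff_add_eq_0[of "\<phi> _"])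
qed

text \<open>The derivation along \<open>x'\<close>, twisted by the substitution of p-th powers: in
  its product rule the other factor is evaluated at those powers.\<close>

abbreviation D :: "('n, int) mpoly \<Rightarrow> ('n, int) mpoly"
  where "D f \<equiv> (\<Sum>j\<in>UNIV. mpoly_subst (\<lambda>k. Var k ^ p) (mpoly_pderiv j f) * x' j)"

text \<open>A first order Taylor expansion, exact because \<open>p\<^sup>2 = 0\<close>.\<close>

lemma \<phi>_mpoly_reduce:
  "\<phi> (mpoly_reduce f) = mpoly_reduce (mpoly_subst (\<lambda>k. Var k ^ p) f) + of_nat p * mpoly_reduce (D f)"
proof (induction f rule: mpoly_induct)
  case (Const c)
  show ?case by (simp add: \<phi>_of_int)
next
  case (Var j)
  have "mpoly_subst (\<lambda>k. Var k ^ p) (mpoly_pderiv i (Var j)) * x' i = (if i = j then x' i else 0)" for i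
    by (simp add: mpoly_pderiv_Var)
  then have "D (Var j) = x' j"
    by simp
  then show ?case
    by (simp add: \<phi>_Var mpoly_reduce_power)
next
  case (add f g)
  have "D (f + g) = D f + D g"
    by (simp add: mpoly_pderiv_add mpoly_subst_add distrib_right sum.distrib)
  with add show ?case
    by (simp add: mpoly_reduce_add \<phi>_add mpoly_subst_add algebra_simps)
next
  case (mult f g)
  have "D (f * g) = D f * mpoly_subst (\<lambda>k. Var k ^ p) g + mpoly_subst (\<lambda>k. Var k ^ p) f * D g"
    by (simp add: mpoly_pderiv_mult mpoly_subst_add mpoly_subst_mult distrib_right distrib_left sum.distrib
        sum_distrib_left sum_distrib_right mult_ac)
  \<comment> \<open>The product of the two correction terms carries the factor p^2 and drops
    out.\<close>
  with mult show ?case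
    by (simp add: mpoly_reduce_add mpoly_reduce_mult \<phi>_mult mpoly_subst_mult distrib_left distrib_right
        mult_ac of_nat_p_square)
qed

lemma \<phi>_mpoly_reduce_eq_power_add:
  "\<phi> (mpoly_reduce f) = mpoly_reduce f ^ p + of_nat p * mpoly_reduce (delta p f + D f)"
proof -
  have "mpoly_subst (\<lambda>k. Var k ^ p) f = f ^ p + of_nat p * delta p f"
    by (simp add: of_nat_mult_delta[OF prime_p])
  then show ?thesis
    unfolding \<phi>_mpoly_reduce by (simp add: mpoly_reduce_hom distrib_left)
qed

text \<open>This descends to the congruence that defines a lift of the Frobenius on the
  quotient.\<close>

lemma \<phi>_eq_power_add: "\<exists>b. \<phi> f = f ^ p + of_nat p * b"
proof -
  obtain F where "mpoly_reduce F = f"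
    using mpoly_reduce_surj by blast
  then show ?thesis
    using \<phi>_mpoly_reduce_eq_power_add[of F] by auto
qed

text \<open>The p-th power is left as that of the whole generator, since this power lies in the
  ideal; only the p-multiple then matters for membership.\<close>

lemma \<phi>_mpoly_reduce_add_of_nat_mult:
  "\<phi> (mpoly_reduce (g + of_nat p * h))
    = mpoly_reduce (g + of_nat p * h) ^ p + of_nat p * mpoly_reduce (delta p g + h ^ p + D g)"
proof -
  have "of_nat p ^ 2 dvd (mpoly_reduce g + of_nat p * mpoly_reduce h) ^ p - mpoly_reduce g ^ p"
    by (rule dvd_power_diff_power_square)
  moreover have "of_nat p ^ 2 * f = 0" for f :: "('n, 'q mod_ring) mpoly"
    by (simp add: power2_eq_square mult.assoc of_nat_p_square)
  ultimately have "(mpoly_reduce g + of_nat p * mpoly_reduce h) ^ p - mpoly_reduce g ^ p = (0 :: ('n, 'q mod_ring) mpoly)"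
    unfolding dvd_def by metis
  then have "mpoly_reduce (g + of_nat p * h) ^ p = (mpoly_reduce g ^ p :: ('n, 'q mod_ring) mpoly)"
    by (simp add: mpoly_reduce_add mpoly_reduce_mult)
  moreover have "\<phi> (mpoly_reduce (g + of_nat p * h)) = \<phi> (mpoly_reduce g) + of_nat p * \<phi> (mpoly_reduce h)"
    by (simp add: mpoly_reduce_hom \<phi>_add \<phi>_mult \<phi>_of_nat)
  moreover have "of_nat p * \<phi> (mpoly_reduce h) = of_nat p * mpoly_reduce (h ^ p)"
    by (simp add: \<phi>_mpoly_reduce_eq_power_add distrib_left of_nat_p_square mpoly_reduce_power)
  ultimately show ?thesis
    by (simp add: \<phi>_mpoly_reduce_eq_power_add mpoly_reduce_add distrib_left)
qed

end

section \<open>Ideals of type class rings\<close>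

lemma ring_of_type_algebra_simps [simp]:
  "carrier (ring_of_type_algebra :: 'a::comm_ring_1 ring) = UNIV"
  "x \<otimes>\<^bsub>ring_of_type_algebra\<^esub> y = x * (y :: 'a)"
  "x \<oplus>\<^bsub>ring_of_type_algebra\<^esub> y = x + (y :: 'a)"
  "\<one>\<^bsub>ring_of_type_algebra\<^esub> = (1 :: 'a)"
  "\<zero>\<^bsub>ring_of_type_algebra\<^esub> = (0 :: 'a)"
  by (simp_all add: ring_of_type_algebra_def)

lemma cring_ring_of_type_algebra: "cring (ring_of_type_algebra :: 'a::comm_ring_1 ring)"
  by (rule cring_from_type_algebra)

lemma ring_ring_of_type_algebra: "ring (ring_of_type_algebra :: 'a::comm_ring_1 ring)"
  by (rule ring_from_type_algebra)

lemma ideal_of_type_algebraI: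
  fixes J :: "'a::comm_ring_1 set"
  assumes "0 \<in> J" and add: "\<And>x y. x \<in> J \<Longrightarrow> y \<in> J \<Longrightarrow> x + y \<in> J"
    and mult: "\<And>c x. x \<in> J \<Longrightarrow> c * x \<in> J"
  shows "ideal J ring_of_type_algebra"
proof (rule idealI)
  interpret ring "ring_of_type_algebra :: 'a ring"
    by (rule ring_ring_of_type_algebra)
  show "Ring.ring (ring_of_type_algebra :: 'a ring)"
    by (rule ring_ring_of_type_algebra)
  have inv: "\<ominus>\<^bsub>ring_of_type_algebra\<^esub> x = - x" for x :: 'a
    by (rule minus_equality) simp_all
  have neg: "- x \<in> J" if "x \<in> J" for x
    using mult[OF that, of "- 1"] by simp
  show "subgroup J (add_monoid ring_of_type_algebra)"
  proof (rule subgroup.intro)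
    fix x assume "x \<in> J"
    then show "inv\<^bsub>add_monoid ring_of_type_algebra\<^esub> x \<in> J"
      using neg inv unfolding a_inv_def by metis
  qed (simp_all add: assms)
qed (use mult in \<open>simp_all add: mult.commute\<close>)

lemma genideal_of_type_algebra:
  fixes G :: "'a::comm_ring_1 set"
  shows ideal_genideal: "ideal (Idl\<^bsub>ring_of_type_algebra\<^esub> G) ring_of_type_algebra"
    and subset_genideal: "G \<subseteq> Idl\<^bsub>ring_of_type_algebra\<^esub> G"
    and genideal_subsetI: "ideal L ring_of_type_algebra \<Longrightarrow> G \<subseteq> L \<Longrightarrow> Idl\<^bsub>ring_of_type_algebra\<^esub> G \<subseteq> L"
proof -
  interpret ring "ring_of_type_algebra :: 'a ring"
    by (rule ring_ring_of_type_algebra)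
  show "ideal (Idl\<^bsub>ring_of_type_algebra\<^esub> G) ring_of_type_algebra"
    by (rule genideal_ideal) simp
  show "G \<subseteq> Idl\<^bsub>ring_of_type_algebra\<^esub> G"
    by (rule genideal_self) simp
  show "Idl\<^bsub>ring_of_type_algebra\<^esub> G \<subseteq> L" if "ideal L ring_of_type_algebra" "G \<subseteq> L"
    using that by (rule genideal_minimal)
qed

locale type_ideal =
  fixes J :: "'a::comm_ring_1 set"
  assumes ideal: "ideal J ring_of_type_algebra"
begin

abbreviation "S \<equiv> (ring_of_type_algebra :: 'a ring)"

lemma zero: "0 \<in> J"
  using additive_subgroup.zero_closed[OF ideal.axioms(1)[OF ideal]] by simp

lemma add: "x \<in> J \<Longrightarrow> y \<in> J \<Longrightarrow> x + y \<in> J"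
  using additive_subgroup.a_closed[OF ideal.axioms(1)[OF ideal], of x y] by simp

lemma mult: "x \<in> J \<Longrightarrow> c * x \<in> J"
  using ideal.I_l_closed[OF ideal, of x c] by simp

lemma minus: "x \<in> J \<Longrightarrow> - x \<in> J"
  using mult[of x "- 1"] by simp

lemma diff: "x \<in> J \<Longrightarrow> y \<in> J \<Longrightarrow> x - y \<in> J"
  using add[of x "- y"] minus[of y] by simp

lemma add_mem_iff: "x \<in> J \<Longrightarrow> x + y \<in> J \<longleftrightarrow> y \<in> J"
  using add[of x y] diff[of "x + y" x] by auto

text \<open>Reading cosets as congruence classes turns calculations in the quotient into ordinary
  type class arithmetic.\<close>

lemma coset: "J +>\<^bsub>S\<^esub> x = {y. y - x \<in> J}"
  by (auto simp: a_r_coset_def' intro: exI[of _ "_ - x"])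

lemma coset_eq_iff: "J +>\<^bsub>S\<^esub> x = J +>\<^bsub>S\<^esub> y \<longleftrightarrow> x - y \<in> J"
proof
  assume "J +>\<^bsub>S\<^esub> x = J +>\<^bsub>S\<^esub> y"
  then show "x - y \<in> J"
    using zero unfolding coset by auto
next
  assume xy: "x - y \<in> J"
  have "z - x \<in> J \<longleftrightarrow> z - y \<in> J" for z
    using add[OF _ xy, of "z - x"] diff[OF _ xy, of "z - y"] by auto
  then show "J +>\<^bsub>S\<^esub> x = J +>\<^bsub>S\<^esub> y"
    by (simp add: coset)
qed

lemma Quot_simps:
  "carrier (S Quot J) = range (\<lambda>x. J +>\<^bsub>S\<^esub> x)"
  "(J +>\<^bsub>S\<^esub> x) \<oplus>\<^bsub>S Quot J\<^esub> (J +>\<^bsub>S\<^esub> y) = J +>\<^bsub>S\<^esub> (x + y)"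
  "(J +>\<^bsub>S\<^esub> x) \<otimes>\<^bsub>S Quot J\<^esub> (J +>\<^bsub>S\<^esub> y) = J +>\<^bsub>S\<^esub> (x * y)"
  "\<one>\<^bsub>S Quot J\<^esub> = J +>\<^bsub>S\<^esub> 1"
  using ideal.a_rcos_sum[OF ideal, of x y] ideal.rcoset_mult_add[OF ideal, of x y]
  by (auto simp: FactRing_def A_RCOSETS_def')

lemma Quot_zero: "\<zero>\<^bsub>S Quot J\<^esub> = J +>\<^bsub>S\<^esub> 0"
  by (simp add: FactRing_def coset)

lemma Quot_nat_pow: "(J +>\<^bsub>S\<^esub> x) [^]\<^bsub>S Quot J\<^esub> (n :: nat) = J +>\<^bsub>S\<^esub> (x ^ n)"
  by (induction n) (simp_all add: nat_pow_def Quot_simps mult.commute)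

lemma Quot_add_pow: "[(n :: nat)] \<cdot>\<^bsub>S Quot J\<^esub> (J +>\<^bsub>S\<^esub> x) = J +>\<^bsub>S\<^esub> (of_nat n * x)"
  by (induction n) (simp_all add: add_pow_def nat_pow_def Quot_simps Quot_zero distrib_right add.commute)

lemma power_mem: "x \<in> J \<Longrightarrow> n > 0 \<Longrightarrow> x ^ n \<in> J"
  using mult[of x "x ^ (n - 1)"] by (cases n) (simp_all add: mult.commute)

end

section \<open>Torsion in flat quotients\<close>

text \<open>The ideal generated by \<open>k\<close>, with \<open>a\<close> encoded as \<open>{[a]}\<close> to live on the type that
  \<^const>\<open>flat_module\<close> quantifies over.\<close>

definition multiples_module :: "'a::comm_ring_1 \<Rightarrow> ('a, 'a list set) module"
  where "multiples_module k =
    \<lparr>carrier = (\<lambda>a. {[a]}) ` {a. k dvd a}, monoid.mult = undefined, monoid.one = undefined,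
     ring.zero = {[0]}, ring.add = (\<lambda>x y. {[hd (the_elem x) + hd (the_elem y)]}),
     module.smult = (\<lambda>a x. {[a * hd (the_elem x)]})\<rparr>"

lemma multiples_module_simps [simp]:
  "carrier (multiples_module k) = (\<lambda>a. {[a]}) ` {a. k dvd a}"
  "\<zero>\<^bsub>multiples_module k\<^esub> = {[0]}"
  "x \<oplus>\<^bsub>multiples_module k\<^esub> y = {[hd (the_elem x) + hd (the_elem y)]}"
  "a \<odot>\<^bsub>multiples_module k\<^esub> x = {[a * hd (the_elem x)]}"
  by (simp_all add: multiples_module_def)

lemma module_multiples_module:
  "Module.module ring_of_type_algebra (multiples_module (k :: 'a::comm_ring_1))"
proof (rule module.intro)
  have "\<exists>y\<in>{a. k dvd a}. y + x = 0" if "k dvd x" for x :: 'a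
    using that by (intro bexI[of _ "- x"]) simp_all
  then show "abelian_group (multiples_module k)"
    by (intro abelian_groupI) (auto simp: add_ac)
  show "cring (ring_of_type_algebra :: 'a ring)"
    by (rule cring_ring_of_type_algebra)
  show "module_axioms ring_of_type_algebra (multiples_module k)"
    by (rule module_axioms.intro) (auto simp: algebra_simps)
qed

section \<open>Tensor relations as a subgroup of formal sums\<close>

context
  fixes R :: "('a, 'm) ring_scheme" and M :: "('a, 'b) module" and N :: "('a, 'c) module"
  assumes M: "Module.module R M" and N: "Module.module R N"
begin

lemma tensor_relators_subset:
  "tensor_relators R M N \<subseteq> carrier (free_Abelian_group (carrier M \<times> carrier N))"
proof -
  have diff: "Poly_Mapping.keys (s - t) \<subseteq> A" if "Poly_Mapping.keys s \<subseteq> A" "Poly_Mapping.keys t \<subseteq> A" for s t :: "'b \<times> 'c \<Rightarrow>\<^sub>0 int" and A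
    using that keys_diff[of s t] by blast
  interpret M: Module.module R M by (rule M)
  interpret N: Module.module R N by (rule N)
  show ?thesis
  proof
    fix t assume "t \<in> tensor_relators R M N"
    then show "t \<in> carrier (free_Abelian_group (carrier M \<times> carrier N))"
      unfolding tensor_relators_def by (auto intro!: diff del: subsetI)
  qed
qed

lemma subgroup_tensor_kernel:
  "subgroup (tensor_kernel R M N) (free_Abelian_group (carrier M \<times> carrier N))"
  unfolding tensor_kernel_def
  by (intro group.generate_is_subgroup tensor_relators_subset group_free_Abelian_group)

lemma tensor_kernel_subset:
  "t \<in> tensor_kernel R M N \<Longrightarrow> Poly_Mapping.keys t \<subseteq> carrier M \<times> carrier N"
  using subgroup.mem_carrier[OF subgroup_tensor_kernel] by simp

lemma tensor_kernel_zero: "0 \<in> tensor_kernel R M N"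
  using subgroup.one_closed[OF subgroup_tensor_kernel] by simp

lemma tensor_kernel_add:
  "s \<in> tensor_kernel R M N \<Longrightarrow> t \<in> tensor_kernel R M N \<Longrightarrow> s + t \<in> tensor_kernel R M N"
  using subgroup.m_closed[OF subgroup_tensor_kernel, of s t] by simp

lemma tensor_kernel_uminus: "t \<in> tensor_kernel R M N \<Longrightarrow> - t \<in> tensor_kernel R M N"
  using subgroup.m_inv_closed[OF subgroup_tensor_kernel, of t] tensor_kernel_subset[of t] by simp

lemma tensor_relators_subset_kernel: "tensor_relators R M N \<subseteq> tensor_kernel R M N"
  unfolding tensor_kernel_def by (auto intro: generate.incl)

end

lemma tensor_kernel_induct [consumes 3, case_names zero relator uminus add]:
  assumes M: "Module.module R M" and N: "Module.module R N" and t: "t \<in> tensor_kernel R M N"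
    and zero: "P 0" and relator: "\<And>t. t \<in> tensor_relators R M N \<Longrightarrow> P t"
    and uminus: "\<And>t. P t \<Longrightarrow> P (- t)" and add: "\<And>s t. P s \<Longrightarrow> P t \<Longrightarrow> P (s + t)"
  shows "P t"
  using t unfolding tensor_kernel_def
proof (induction rule: generate.induct)
  \<comment> \<open>The group inverse is negation only on the carrier, hence the appeal to
    \<open>tensor_relators_subset\<close>.\<close>
  case (inv h)
  then show ?case
    using tensor_relators_subset[OF M N] relator uminus by auto
qed (simp_all add: zero relator add)

text \<open>For an inclusion, the induced map leaves formal sums unchanged and merely enlarges the
  kernel. The classes of \<open>t\<close> and 0 then have the same image, and injectivity identifies
  them.\<close>

lemma flat_module_tensor_kernel:
  fixes R :: "('a, 'm) ring_scheme" and M M' :: "('a, 'a list set) module" and N :: "('a, 'c) module"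
  assumes flat: "flat_module R N" and M: "Module.module R M" and M': "Module.module R M'"
    and sub: "carrier M \<subseteq> carrier M'"
    and add: "\<And>x y. x \<in> carrier M \<Longrightarrow> y \<in> carrier M \<Longrightarrow> x \<oplus>\<^bsub>M\<^esub> y = x \<oplus>\<^bsub>M'\<^esub> y"
    and smult: "\<And>a x. a \<in> carrier R \<Longrightarrow> x \<in> carrier M \<Longrightarrow> a \<odot>\<^bsub>M\<^esub> x = a \<odot>\<^bsub>M'\<^esub> x"
    and t: "Poly_Mapping.keys t \<subseteq> carrier M \<times> carrier N" "t \<in> tensor_kernel R M' N"
  shows "t \<in> tensor_kernel R M N"
proof -
  have N: "Module.module R N"
    using flat by (simp add: flat_module_def)
  let ?G = "free_Abelian_group (carrier M \<times> carrier N)"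
  let ?G' = "free_Abelian_group (carrier M' \<times> carrier N)"
  let ?K = "tensor_kernel R M N" and ?K' = "tensor_kernel R M' N"
  let ?f = "tensor_map R M' N (\<lambda>x. x)"
  have "(\<lambda>x. x) \<in> module_homs R M M'"
    using sub add smult by (auto simp: module_homs_def)
  then have inj: "inj_on ?f (carrier (tensor_product R M N))"
    using flat M M' inj_on_id2[of "carrier M"] unfolding flat_module_def by blast
  have rel: "tensor_relators R M N \<subseteq> tensor_relators R M' N"
    unfolding tensor_relators_def
    by (intro Un_mono Collect_mono; metis add smult subsetD[OF sub])
  have KK': "?K \<subseteq> ?K'"
  proof
    show "s \<in> ?K'" if "s \<in> ?K" for s
      using M N that
    proof (induction rule: tensor_kernel_induct)
      case (relator s)
      then show ?case
        using rel tensor_relators_subset_kernel[OF M' N] by blast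
    qed (simp_all add: tensor_kernel_zero tensor_kernel_uminus tensor_kernel_add M' N)
  qed
  \<comment> \<open>\<open>tensor_map\<close> takes \<open>the_elem\<close> of a set of cosets, so
    that set has to be shown a singleton.\<close>
  have f: "?f T = ?K'" if "T \<subseteq> ?K'" "T \<noteq> {}" for T
  proof -
    have "(\<lambda>(x, z). frag_of (x, z)) = (frag_of :: 'a list set \<times> 'c \<Rightarrow> _)"
      by auto
    then have "frag_extend (\<lambda>(x, z). frag_of (x, z)) s = s" for s :: "'a list set \<times> 'c \<Rightarrow>\<^sub>0 int"
      using frag_expansion[of s] by simp
    moreover have "?K' #>\<^bsub>?G'\<^esub> s = ?K'" if "s \<in> ?K'" for s
      by (rule subgroup.rcos_const[OF subgroup_tensor_kernel[OF M' N] group_free_Abelian_group that])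
    ultimately have "(\<lambda>t. ?K' #>\<^bsub>?G'\<^esub> frag_extend (\<lambda>(x, z). frag_of (x, z)) t) ` T = {?K'}"
      using that by (auto simp: image_iff)
    then show ?thesis
      by (simp add: tensor_map_def)
  qed
  have coset: "?K #>\<^bsub>?G\<^esub> s = (\<lambda>u. u + s) ` ?K" for s
    by (auto simp: r_coset_def)
  have carr: "?K #>\<^bsub>?G\<^esub> s \<in> carrier (tensor_product R M N)" if "Poly_Mapping.keys s \<subseteq> carrier M \<times> carrier N" for s
    using that by (auto simp: tensor_product_def FactGroup_def RCOSETS_def)
  have "?K #>\<^bsub>?G\<^esub> t = ?K #>\<^bsub>?G\<^esub> 0"
  proof (rule inj_onD[OF inj])
    have "?K #>\<^bsub>?G\<^esub> s \<subseteq> ?K'" if "s \<in> ?K'" for s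
      unfolding coset using KK' tensor_kernel_add[OF M' N _ that] by auto
    moreover have "?K #>\<^bsub>?G\<^esub> s \<noteq> {}" for s
      unfolding coset using tensor_kernel_zero[OF M N] by auto
    ultimately show "?f (?K #>\<^bsub>?G\<^esub> t) = ?f (?K #>\<^bsub>?G\<^esub> 0)"
      using t(2) tensor_kernel_zero[OF M' N] by (simp add: f)
  qed (use t in \<open>simp_all add: carr\<close>)
  then have "(\<lambda>u. u + t) ` ?K = ?K"
    by (simp add: coset)
  then show ?thesis
    using tensor_kernel_zero[OF M N] by (metis add_0 imageI)
qed

text \<open>
  With \<open>M\<close> the ideal generated by \<open>k\<close> and \<open>B\<close> the quotient ring, flatness forces
  \<open>k \<otimes> f = 0\<close> in \<open>M \<otimes> B\<close> as soon as \<open>k f = 0\<close> in \<open>B\<close>.  Since \<open>k\<close> annihilates only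
  its own multiples, \<open>k a \<otimes> f \<mapsto> a f\<close> is a well-defined map from \<open>M \<otimes> B\<close> to \<open>B / k B\<close>, so \<open>f\<close> is
  divisible by \<open>k\<close> in \<open>B\<close>.
\<close>

lemma flat_quotient_torsion:
  fixes \<iota> :: "'a::comm_ring_1 \<Rightarrow> 'b::comm_ring_1" and J :: "'b set"
  assumes J: "ideal J ring_of_type_algebra"
    and flat: "flat_module ring_of_type_algebra
      (module_via (\<lambda>c. J +>\<^bsub>ring_of_type_algebra\<^esub> \<iota> c) (ring_of_type_algebra Quot J))"
    and \<iota>_one: "\<iota> 1 = 1" and \<iota>_add: "\<And>a b. \<iota> (a + b) = \<iota> a + \<iota> b"
    and \<iota>_mult: "\<And>a b. \<iota> (a * b) = \<iota> a * \<iota> b"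
    and ann: "\<And>a. k * a = 0 \<Longrightarrow> k dvd a"
    and f: "\<iota> k * f \<in> J"
  shows "\<exists>u\<in>J. \<exists>v. f = u + \<iota> k * v"
proof -
  interpret J: type_ideal J
    by (rule type_ideal.intro) (rule J)
  let ?S = "ring_of_type_algebra :: 'b ring"
  let ?q = "\<lambda>x. J +>\<^bsub>?S\<^esub> x"
  define R where "R = (ring_of_type_algebra :: 'a ring)"
  define N where "N = module_via (\<lambda>c. ?q (\<iota> c)) (?S Quot J)"
  \<comment> \<open>The multiples of 1 form the whole ring in the same encoding, so
    \<open>?M\<close> sits in \<open>?M'\<close> by a literal inclusion.\<close>
  let ?M = "multiples_module k" and ?M' = "multiples_module (1 :: 'a)"
  have N_simps: "carrier N = range ?q" "?q x \<oplus>\<^bsub>N\<^esub> ?q y = ?q (x + y)" "a \<odot>\<^bsub>N\<^esub> ?q x = ?q (\<iota> a * x)" for x y a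
    by (simp_all add: N_def module_via_def J.Quot_simps)
  have flat: "flat_module R N"
    using flat by (simp add: R_def N_def)
  then have N: "Module.module R N"
    by (simp add: flat_module_def)
  have M: "Module.module R ?M" and M': "Module.module R ?M'"
    by (simp_all add: R_def module_multiples_module)
  note rel = tensor_relators_subset_kernel[OF M' N, THEN subsetD]

  \<comment> \<open>Additivity applied to 0 + 0 gives minus this formal sum as a relator.\<close>
  have zero: "frag_of ({[1]}, ?q 0) \<in> tensor_kernel R ?M' N"
  proof -
    have "frag_of ({[1]}, ?q 0 \<oplus>\<^bsub>N\<^esub> ?q 0) - frag_of ({[1]}, ?q 0) - frag_of ({[1]}, ?q 0) \<in> tensor_relators R ?M' N"
      unfolding tensor_relators_def
      by (rule UnI1, rule UnI2, intro CollectI exI[of _ "{[1]}"] exI[of _ "?q 0"]) (simp add: N_simps(1))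
    from tensor_kernel_uminus[OF M' N rel[OF this]] show ?thesis
      by (simp add: N_simps)
  qed
  \<comment> \<open>Over the whole ring, k tensor f equals 1 tensor k f, which is 1 tensor 0. The
    factor 1 need not lie in \<open>?M\<close>; flatness carries the vanishing back there.\<close>
  have "?q (\<iota> k * f) = ?q 0"
    using f by (simp add: J.coset_eq_iff)
  then have "frag_of ({[k]}, ?q f) - frag_of ({[1]}, ?q 0) \<in> tensor_relators R ?M' N"
    unfolding tensor_relators_def
    by (intro UnI2 CollectI exI[of _ k] exI[of _ "{[1]}"] exI[of _ "?q f"]) (simp add: N_simps R_def)
  from tensor_kernel_add[OF M' N rel[OF this] zero]
  have "frag_of ({[k]}, ?q f) \<in> tensor_kernel R ?M' N"
    by simp
  then have ker: "frag_of ({[k]}, ?q f) \<in> tensor_kernel R ?M N"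
    by (intro flat_module_tensor_kernel[OF flat M M']) (auto simp: N_simps)

  \<comment> \<open>The preimage in \<open>?S\<close> of the ideal k B.\<close>
  define K where "K = {u + \<iota> k * v |u v. u \<in> J}"
  have J_K: "u \<in> K" if "u \<in> J" for u
    unfolding K_def using that by (intro CollectI exI[of _ u] exI[of _ 0]) simp
  have k_K: "\<iota> (k * a) * v \<in> K" for a v
    unfolding K_def using J.zero by (intro CollectI exI[of _ 0] exI[of _ "\<iota> a * v"]) (simp add: \<iota>_mult mult.assoc)
  have K_add: "x + y \<in> K" if "x \<in> K" "y \<in> K" for x y
  proof -
    from that obtain u v u' v' where "x = u + \<iota> k * v" "u \<in> J" "y = u' + \<iota> k * v'" "u' \<in> J"
      unfolding K_def by blast
    then show ?thesis
      unfolding K_def using J.add[of u u']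
      by (intro CollectI exI[of _ "u + u'"] exI[of _ "v + v'"]) (simp add: distrib_left add_ac)
  qed
  have K_mult: "c * x \<in> K" if "x \<in> K" for c x
  proof -
    from that obtain u v where "x = u + \<iota> k * v" "u \<in> J"
      unfolding K_def by blast
    then show ?thesis
      unfolding K_def using J.mult[of u c]
      by (intro CollectI exI[of _ "c * u"] exI[of _ "c * v"]) (simp add: distrib_left mult_ac)
  qed
  have \<iota>_zero: "\<iota> 0 = 0"
    using \<iota>_add[of 0 0] by simp
  have \<iota>_diff: "\<iota> (a - b) = \<iota> a - \<iota> b" for a b
    using \<iota>_add[of "a - b" b] by simp

  \<comment> \<open>Arbitrary choices of a quotient by k and of a coset representative. Neither need
    be additive; \<open>quo_cong\<close> and \<open>rep_cong\<close> show that the errors lie in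
    \<open>K\<close>.\<close>
  define quo where "quo x = (SOME a. hd (the_elem x) = k * a)" for x :: "'a list set"
  define rep where "rep z = (SOME y. z = ?q y)" for z
  have quo: "k * quo {[a]} = a" if "k dvd a" for a
    unfolding quo_def using someI_ex[of "\<lambda>b. a = k * b"] that by (auto simp: dvd_def)
  have rep: "rep (?q y) - y \<in> J" for y
  proof -
    have "?q y = ?q (rep (?q y))"
      unfolding rep_def by (rule someI_ex) blast
    then show ?thesis
      using J.coset_eq_iff J.minus[of "y - rep (?q y)"] by simp
  qed
  define e where "e = (\<lambda>(x, z). \<iota> (quo x) * rep z)"
  define E where "E t = (\<Sum>i\<in>Poly_Mapping.keys t. of_int (Poly_Mapping.lookup t i) * e i)" for t
  have E_add: "E (s + t) = E s + E t" for s t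
    unfolding E_def by (rule setsum_keys_plus_distrib) (simp_all add: distrib_right)
  have E_0: "E 0 = 0"
    by (simp add: E_def)
  have E_uminus: "E (- t) = - E t" for t
    using E_add[of t "- t"] by (simp add: E_0 eq_neg_iff_add_eq_0 add.commute)
  have E_diff: "E (s - t) = E s - E t" for s t
    using E_add[of s "- t"] by (simp add: E_uminus)
  have E_of: "E (frag_of i) = e i" for i
    by (simp add: E_def)
  \<comment> \<open>Two quotients of \<open>b\<close> by k differ by an annihilator of k, which
    \<open>ann\<close> turns into a multiple of k.\<close>
  have quo_cong: "\<iota> (quo {[b]} - c) * v \<in> K" if "k dvd b" "k * c = b" for b c v
  proof -
    have "k * (quo {[b]} - c) = 0"
      using that by (simp add: right_diff_distrib quo)
    then obtain d where "quo {[b]} - c = k * d"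
      using ann unfolding dvd_def by blast
    then show ?thesis
      using k_K[of d v] by simp
  qed
  have rep_cong: "c * (rep (?q y) - y) \<in> K" for c y
    using J_K[OF J.mult[OF rep]] .
  \<comment> \<open>Well-definedness of the map into B / k B: on each kind of relator,
    \<open>E\<close> is a sum of choice errors.\<close>
  have "E t \<in> K" if "t \<in> tensor_kernel R ?M N" for t
    using M N that
  proof (induction rule: tensor_kernel_induct)
    case zero
    then show ?case
      using J_K[OF J.zero] by (simp add: E_0)
  next
    case (relator t)
    then consider
      (left) a b z where "k dvd a" "k dvd b" "t = frag_of ({[a + b]}, z) - frag_of ({[a]}, z) - frag_of ({[b]}, z)"
      | (right) a y y' where "t = frag_of ({[a]}, ?q (y + y')) - frag_of ({[a]}, ?q y) - frag_of ({[a]}, ?q y')"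
      | (scalar) c a y where "k dvd a" "t = frag_of ({[c * a]}, ?q y) - frag_of ({[a]}, ?q (\<iota> c * y))"
      unfolding tensor_relators_def by (auto simp: N_simps)
    then show ?case
    proof cases
      case left
      have "E t = \<iota> (quo {[a + b]} - (quo {[a]} + quo {[b]})) * rep z"
        by (simp add: left E_diff E_add E_of e_def \<iota>_diff \<iota>_add algebra_simps)
      also have "\<dots> \<in> K"
        using left by (intro quo_cong) (simp_all add: distrib_left quo)
      finally show ?thesis .
    next
      case right
      have "E t = \<iota> (quo {[a]}) * (rep (?q (y + y')) - (y + y'))
          + (- \<iota> (quo {[a]}) * (rep (?q y) - y) + - \<iota> (quo {[a]}) * (rep (?q y') - y'))"
        by (simp add: right E_diff E_add E_of e_def algebra_simps)
      also have "\<dots> \<in> K"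
        by (intro K_add rep_cong)
      finally show ?thesis .
    next
      case scalar
      have "E t = \<iota> (quo {[c * a]} - c * quo {[a]}) * rep (?q y)
          + (\<iota> (c * quo {[a]}) * (rep (?q y) - y) + - \<iota> (quo {[a]}) * (rep (?q (\<iota> c * y)) - \<iota> c * y))"
        by (simp add: scalar E_diff E_add E_of e_def \<iota>_diff \<iota>_mult algebra_simps)
      also have "\<dots> \<in> K"
        using scalar by (intro K_add rep_cong quo_cong) (simp_all add: mult.left_commute quo)
      finally show ?thesis .
    qed
  next
    case (uminus t)
    then show ?case
      using K_mult[of "E t" "- 1"] by (simp add: E_uminus)
  next
    case (add s t)
    then show ?case
      by (simp add: E_add K_add)
  qed
  from this[OF ker] have "\<iota> (quo {[k]}) * rep (?q f) \<in> K"
    by (simp add: E_of e_def)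
  \<comment> \<open>The chosen quotient of k by itself is 1 only up to a multiple of k, and the
    representative is \<open>f\<close> only up to \<open>J\<close>; both errors lie in
    \<open>K\<close>.\<close>
  moreover have "f = \<iota> (quo {[k]}) * rep (?q f)
      + (- 1 * (\<iota> (quo {[k]} - 1) * rep (?q f)) + (- 1) * (rep (?q f) - f))"
    by (simp add: \<iota>_diff \<iota>_one algebra_simps)
  ultimately have "f \<in> K"
    using quo_cong[of k 1] rep_cong K_mult K_add by (metis dvd_refl mult_1_right)
  then show ?thesis
    unfolding K_def by blast
qed


section \<open>Lifts of the Frobenius\<close>

context frobenius_perturbation
begin

section \<open>Comparison of reductions modulo p and p^2\<close>

lemma mpoly_reduce_q_eq_0_iff:
  "mpoly_reduce f = (0 :: ('n, 'q mod_ring) mpoly) \<longleftrightarrow> (\<forall>m. int p ^ 2 dvd Poly_Mapping.lookup f m)"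
  by (simp add: mpoly_reduce_eq_0_iff card_q)

text \<open>Multiplication by p on polynomials over Z/p^2 thus factors through reduction modulo
  p.\<close>

lemma of_nat_mult_mpoly_reduce_eq_0:
  assumes "mpoly_reduce f = (0 :: ('n, 'p::nontriv mod_ring) mpoly)" and "CARD('p) = p"
  shows "of_nat p * mpoly_reduce f = (0 :: ('n, 'q mod_ring) mpoly)"
proof -
  have "mpoly_reduce (of_nat p * f) = (0 :: ('n, 'q mod_ring) mpoly)"
    using assms by (simp add: mpoly_reduce_q_eq_0_iff mpoly_reduce_eq_0_iff lookup_of_nat_mult power2_eq_square)
  then show ?thesis
    by (simp add: mpoly_reduce_mult)
qed

lemma mpoly_reduce_p_eq_0:
  assumes "mpoly_reduce f = (0 :: ('n, 'q mod_ring) mpoly)" and "CARD('p::nontriv) = p"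
  shows "mpoly_reduce f = (0 :: ('n, 'p mod_ring) mpoly)"
  using assms by (auto simp: mpoly_reduce_q_eq_0_iff mpoly_reduce_eq_0_iff power2_eq_square intro: dvd_mult_left)

lemma of_nat_p_eq_0: "CARD('p::nontriv) = p \<Longrightarrow> of_nat p = (0 :: ('n, 'p mod_ring) mpoly)"
  by (metis of_nat_card_eq_0 single_of_nat single_zero)

text \<open>For an integer representative, p^2 divides p c, and one factor p cancels. This supplies
  the annihilator condition of \<open>flat_quotient_torsion\<close>.\<close>

lemma annihilator_of_nat_p:
  assumes "of_nat p * a = (0 :: 'q mod_ring)"
  shows "of_nat p dvd a"
proof -
  define c where "c = to_int_mod_ring a"
  have a: "a = of_int c"
    by (simp add: c_def of_int_of_int_mod_ring)
  have "of_int (int p * c) = (0 :: 'q mod_ring)"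
    using assms by (simp add: a)
  then have "int p * int p dvd int p * c"
    unfolding of_int_mod_ring_eq_0_iff card_q by (simp add: power2_eq_square)
  then have "int p dvd c"
    using prime_gt_0_nat[OF prime_p] by simp
  then obtain d where "c = int p * d" ..
  then show ?thesis
    by (simp add: a)
qed

end

text \<open>The second and third conjuncts render the remark on B: being induced by \<phi> means
  commuting with the quotient map.\<close>

theorem mainTheorem1:
  fixes p r :: nat
    and g h :: "nat \<Rightarrow> ('n::finite, int) mpoly"
    and x' :: "'n \<Rightarrow> ('n, int) mpoly"
    and \<phi> :: "('n, 'q::nontriv mod_ring) mpoly \<Rightarrow> ('n, 'q mod_ring) mpoly"
  defines "Fpx \<equiv> (ring_of_type_algebra :: ('n, 'p::nontriv mod_ring) mpoly ring)"
    and "Zp2 \<equiv> (ring_of_type_algebra :: 'q mod_ring ring)"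
    and "Zp2x \<equiv> (ring_of_type_algebra :: ('n, 'q mod_ring) mpoly ring)"
  defines "I \<equiv> Idl\<^bsub>Fpx\<^esub> ((\<lambda>i. mpoly_reduce (g i)) ` {1..r})"
    and "I' \<equiv> Idl\<^bsub>Zp2x\<^esub> ((\<lambda>i. mpoly_reduce (g i + of_nat p * h i)) ` {1..r})"
  defines "B \<equiv> Zp2x Quot I'"
  assumes "Factorial_Ring.prime p" and "CARD('p) = p" and "CARD('q) = p ^ 2"
    and "r \<ge> 1"
    and "\<And>i m. i \<in> {1..r} \<Longrightarrow> Poly_Mapping.lookup (g i) m \<in> {0..int p - 1}"
    and "flat_module Zp2 (module_via (\<lambda>c. I' +>\<^bsub>Zp2x\<^esub> Const c) B)"
    and "\<phi> \<in> Ring.ring_hom Zp2x Zp2x"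
    and "\<And>j. \<phi> (Var j) = Var j ^ p + of_nat p * mpoly_reduce (x' j)"
  shows "(\<phi> ` I' \<subseteq> I' \<longleftrightarrow>
            (\<forall>i\<in>{1..r}.
               mpoly_reduce (delta p (g i) + h i ^ p +
                 (\<Sum>j\<in>UNIV. mpoly_subst (\<lambda>k. Var k ^ p) (mpoly_pderiv j (g i)) * x' j)) \<in> I)) \<and>
         (\<phi> ` I' \<subseteq> I' \<longleftrightarrow>
            (\<exists>\<psi>\<in>Ring.ring_hom B B. \<forall>f\<in>carrier Zp2x. \<psi> (I' +>\<^bsub>Zp2x\<^esub> f) = I' +>\<^bsub>Zp2x\<^esub> \<phi> f)) \<and>
         (\<forall>\<psi>\<in>Ring.ring_hom B B.
            (\<forall>f\<in>carrier Zp2x. \<psi> (I' +>\<^bsub>Zp2x\<^esub> f) = I' +>\<^bsub>Zp2x\<^esub> \<phi> f) \<longrightarrow> frobenius_lift p B \<psi>)"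
proof -
  note prime_p = \<open>Factorial_Ring.prime p\<close> and card_p = \<open>CARD('p) = p\<close>
  interpret frobenius_perturbation p x' \<phi>
  proof
    show "\<phi> 1 = 1" "\<phi> (a + b) = \<phi> a + \<phi> b" "\<phi> (a * b) = \<phi> a * \<phi> b" for a b
      using ring_hom_one[OF \<open>\<phi> \<in> Ring.ring_hom Zp2x Zp2x\<close>]
        ring_hom_add[OF \<open>\<phi> \<in> Ring.ring_hom Zp2x Zp2x\<close>, of a b]
        ring_hom_mult[OF \<open>\<phi> \<in> Ring.ring_hom Zp2x Zp2x\<close>, of a b]
      by (simp_all add: Zp2x_def)
  qed (fact assms)+
  interpret I: type_ideal I
    unfolding I_def Fpx_def by (rule type_ideal.intro) (rule ideal_genideal)
  interpret I': type_ideal I'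
    unfolding I'_def Zp2x_def by (rule type_ideal.intro) (rule ideal_genideal)
  let ?rp = "mpoly_reduce :: _ \<Rightarrow> ('n, 'p mod_ring) mpoly"
  let ?rq = "mpoly_reduce :: _ \<Rightarrow> ('n, 'q mod_ring) mpoly"
  let ?gen = "\<lambda>i. g i + of_nat p * h i"
  let ?q = "\<lambda>f. I' +>\<^bsub>Zp2x\<^esub> f"
  have rp_gen: "?rp (?gen i) = ?rp (g i)" for i
    by (simp add: mpoly_reduce_add mpoly_reduce_mult of_nat_p_eq_0[OF card_p])
  have gen_I: "?rp (g i) \<in> I" if "i \<in> {1..r}" for i
    using subset_genideal[of "(\<lambda>i. ?rp (g i)) ` {1..r}"] that unfolding I_def Fpx_def by blast
  have gen_I': "?rq (?gen i) \<in> I'" if "i \<in> {1..r}" for i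
    using subset_genideal[of "(\<lambda>i. ?rq (?gen i)) ` {1..r}"] that unfolding I'_def Zp2x_def by blast

  have I_I': "of_nat p * ?rq F \<in> I'" if "?rp F \<in> I" for F
  proof -
    \<comment> \<open>Only some representative is required to be good, which makes \<open>L\<close>
      an ideal containing the generators of \<open>I\<close>. Since p F depends only on F modulo p,
      the property passes to every representative.\<close>
    define L where "L = {?rp F |F. of_nat p * ?rq F \<in> I'}"
    have "ideal L Fpx"
      unfolding Fpx_def
    proof (rule ideal_of_type_algebraI)
      show "0 \<in> L"
        unfolding L_def using I'.zero by (intro CollectI exI[of _ 0]) simp
    next
      fix x y assume "x \<in> L" "y \<in> L"
      then obtain F G where "x = ?rp F" "of_nat p * ?rq F \<in> I'" "y = ?rp G" "of_nat p * ?rq G \<in> I'"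
        unfolding L_def by blast
      then show "x + y \<in> L"
        unfolding L_def using I'.add[of "of_nat p * ?rq F" "of_nat p * ?rq G"]
        by (intro CollectI exI[of _ "F + G"]) (simp add: mpoly_reduce_add distrib_left)
    next
      fix c x assume "x \<in> L"
      then obtain F where F: "x = ?rp F" "of_nat p * ?rq F \<in> I'"
        unfolding L_def by blast
      obtain C where "c = ?rp C"
        using mpoly_reduce_surj by metis
      with F show "c * x \<in> L"
        unfolding L_def using I'.mult[of "of_nat p * ?rq F" "?rq C"]
        by (intro CollectI exI[of _ "C * F"]) (simp add: mpoly_reduce_mult mult_ac)
    qed
    moreover have "?rp (g i) \<in> L" if "i \<in> {1..r}" for i
      unfolding L_def rp_gen[symmetric] using I'.mult[OF gen_I'[OF that], of "of_nat p"] by blast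
    ultimately have "I \<subseteq> L"
      unfolding I_def Fpx_def by (intro genideal_subsetI) auto
    then obtain G where G: "?rp F = ?rp G" "of_nat p * ?rq G \<in> I'"
      using \<open>?rp F \<in> I\<close> unfolding L_def by blast
    have "of_nat p * ?rq (F - G) = 0"
      using G by (intro of_nat_mult_mpoly_reduce_eq_0[OF _ card_p]) (simp add: mpoly_reduce_diff)
    then show ?thesis
      using G by (simp add: mpoly_reduce_diff right_diff_distrib)
  qed

  have I'_I: "?rp F \<in> I" if "?rq F \<in> I'" for F
  proof -
    \<comment> \<open>The same argument with the moduli exchanged: \<open>L\<close> consists of the
      classes modulo p^2 of polynomials that reduce into \<open>I\<close>.\<close>
    define L where "L = {?rq F |F. ?rp F \<in> I}"
    have "ideal L Zp2x"
      unfolding Zp2x_def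
    proof (rule ideal_of_type_algebraI)
      show "0 \<in> L"
        unfolding L_def using I.zero by (intro CollectI exI[of _ 0]) simp
    next
      fix x y assume "x \<in> L" "y \<in> L"
      then obtain F G where "x = ?rq F" "?rp F \<in> I" "y = ?rq G" "?rp G \<in> I"
        unfolding L_def by blast
      then show "x + y \<in> L"
        unfolding L_def using I.add[of "?rp F" "?rp G"]
        by (intro CollectI exI[of _ "F + G"]) (simp add: mpoly_reduce_add)
    next
      fix c x assume "x \<in> L"
      then obtain F where F: "x = ?rq F" "?rp F \<in> I"
        unfolding L_def by blast
      obtain C where "c = ?rq C"
        using mpoly_reduce_surj by metis
      with F show "c * x \<in> L"
        unfolding L_def using I.mult[of "?rp F" "?rp C"]
        by (intro CollectI exI[of _ "C * F"]) (simp add: mpoly_reduce_mult)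
    qed
    moreover have "?rq (?gen i) \<in> L" if "i \<in> {1..r}" for i
      unfolding L_def using gen_I[OF that] rp_gen[of i] by auto
    ultimately have "I' \<subseteq> L"
      unfolding I'_def Zp2x_def by (intro genideal_subsetI) auto
    then obtain G where G: "?rq F = ?rq G" "?rp G \<in> I"
      using \<open>?rq F \<in> I'\<close> unfolding L_def by blast
    have "?rp (F - G) = 0"
      using G by (intro mpoly_reduce_p_eq_0[OF _ card_p]) (simp add: mpoly_reduce_diff)
    then show ?thesis
      using G by (simp add: mpoly_reduce_diff)
  qed

  have mult_p_iff: "of_nat p * ?rq F \<in> I' \<longleftrightarrow> ?rp F \<in> I" for F
  proof
    assume F: "of_nat p * ?rq F \<in> I'"
    have Const_p: "Const (of_nat p) = (of_nat p :: ('n, 'q mod_ring) mpoly)"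
      by (simp add: Const_def)
    \<comment> \<open>Flatness enters here. Reducing the resulting decomposition modulo p kills the
      term p v and puts u into \<open>I\<close>.\<close>
    have "\<exists>u\<in>I'. \<exists>v. ?rq F = u + Const (of_nat p) * v"
    proof (rule flat_quotient_torsion[where \<iota> = Const and k = "of_nat p"])
      show "ideal I' ring_of_type_algebra"
        by (rule I'.ideal)
      show "flat_module ring_of_type_algebra (module_via
          (\<lambda>c :: 'q mod_ring. I' +>\<^bsub>ring_of_type_algebra\<^esub> Const c) (ring_of_type_algebra Quot I'))"
        using \<open>flat_module Zp2 _\<close> unfolding Zp2_def Zp2x_def B_def .
      show "Const (of_nat p :: 'q mod_ring) * ?rq F \<in> I'"
        using F by (simp only: Const_p)
    qed (simp_all add: Const_add Const_mult annihilator_of_nat_p, simp add: Const_def)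
    then obtain u v where u: "u \<in> I'" "?rq F = u + of_nat p * v"
      unfolding Const_p by blast
    obtain V where "?rq V = v"
      using mpoly_reduce_surj by blast
    with u have "?rq (F - of_nat p * V) \<in> I'"
      by (simp add: mpoly_reduce_diff mpoly_reduce_mult)
    from I'_I[OF this] show "?rp F \<in> I"
      by (simp add: mpoly_reduce_diff mpoly_reduce_mult of_nat_p_eq_0[OF card_p])
  qed (rule I_I')

  have stable_iff: "\<phi> ` I' \<subseteq> I' \<longleftrightarrow> (\<forall>i\<in>{1..r}. \<phi> (?rq (?gen i)) \<in> I')"
  proof
    assume gens: "\<forall>i\<in>{1..r}. \<phi> (?rq (?gen i)) \<in> I'"
    \<comment> \<open>The preimage of an ideal under \<phi> is an ideal, so checking the generators
      is enough.\<close>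
    have "ideal {f. \<phi> f \<in> I'} Zp2x"
      unfolding Zp2x_def
      by (rule ideal_of_type_algebraI) (simp_all add: \<phi>_zero \<phi>_add \<phi>_mult I'.zero I'.add I'.mult)
    then have "I' \<subseteq> {f. \<phi> f \<in> I'}"
      using gens unfolding I'_def Zp2x_def by (intro genideal_subsetI) auto
    then show "\<phi> ` I' \<subseteq> I'"
      by blast
  qed (use gen_I' in blast)

  let ?E = "\<lambda>i. delta p (g i) + h i ^ p +
    (\<Sum>j\<in>UNIV. mpoly_subst (\<lambda>k. Var k ^ p) (mpoly_pderiv j (g i)) * x' j)"
  have "\<phi> (?rq (?gen i)) \<in> I' \<longleftrightarrow> ?rp (?E i) \<in> I" if "i \<in> {1..r}" for i
  proof -
    have pow: "?rq (?gen i) ^ p \<in> I'"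
      using gen_I'[OF that] prime_gt_0_nat[OF prime_p] by (rule I'.power_mem)
    have "\<phi> (?rq (?gen i)) \<in> I' \<longleftrightarrow> of_nat p * ?rq (?E i) \<in> I'"
      unfolding \<phi>_mpoly_reduce_add_of_nat_mult by (rule I'.add_mem_iff[OF pow])
    then show ?thesis
      by (simp only: mult_p_iff)
  qed
  then have 1: "\<phi> ` I' \<subseteq> I' \<longleftrightarrow> (\<forall>i\<in>{1..r}. ?rp (?E i) \<in> I)"
    unfolding stable_iff by blast

  \<comment> \<open>The induced endomorphism of the quotient ring\<close>
  have q_eq_iff: "?q x = ?q y \<longleftrightarrow> x - y \<in> I'" for x y
    unfolding Zp2x_def by (rule I'.coset_eq_iff)
  have B_simps: "carrier B = range ?q" "?q x \<oplus>\<^bsub>B\<^esub> ?q y = ?q (x + y)"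
    "?q x \<otimes>\<^bsub>B\<^esub> ?q y = ?q (x * y)" "\<one>\<^bsub>B\<^esub> = ?q 1" for x y
    unfolding B_def Zp2x_def by (rule I'.Quot_simps)+
  have 2: "\<phi> ` I' \<subseteq> I' \<longleftrightarrow> (\<exists>\<psi>\<in>Ring.ring_hom B B. \<forall>f\<in>carrier Zp2x. \<psi> (?q f) = ?q (\<phi> f))"
  proof
    assume stable: "\<phi> ` I' \<subseteq> I'"
    \<comment> \<open>Defined through a chosen representative; stability of \<open>I'\<close> makes
      the value independent of the choice.\<close>
    define \<psi> where "\<psi> z = ?q (\<phi> (SOME f. z = ?q f))" for z
    have \<psi>: "\<psi> (?q f) = ?q (\<phi> f)" for f
    proof -
      define f' where "f' = (SOME f'. ?q f = ?q f')"
      have "?q f = ?q f'"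
        unfolding f'_def by (rule someI_ex) blast
      then have "\<phi> (f' - f) \<in> I'"
        using stable q_eq_iff[of f' f] by auto
      moreover have "\<phi> f' = \<phi> (f' - f) + \<phi> f"
        by (simp flip: \<phi>_add)
      ultimately have "?q (\<phi> f') = ?q (\<phi> f)"
        by (simp add: q_eq_iff)
      then show ?thesis
        unfolding \<psi>_def f'_def .
    qed
    have "\<psi> \<in> Ring.ring_hom B B"
      by (rule ring_hom_memI) (auto simp: B_simps \<psi> \<phi>_add \<phi>_mult \<phi>_one)
    with \<psi> show "\<exists>\<psi>\<in>Ring.ring_hom B B. \<forall>f\<in>carrier Zp2x. \<psi> (?q f) = ?q (\<phi> f)"
      by blast
  next
    assume "\<exists>\<psi>\<in>Ring.ring_hom B B. \<forall>f\<in>carrier Zp2x. \<psi> (?q f) = ?q (\<phi> f)"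
    then obtain \<psi> where \<psi>: "\<psi> (?q f) = ?q (\<phi> f)" for f
      by (auto simp: Zp2x_def)
    have "\<phi> f \<in> I'" if "f \<in> I'" for f
    proof -
      \<comment> \<open>Conversely, members of \<open>I'\<close> share the coset of 0, so \<psi>
        must send that coset to the one of \<open>\<phi> 0\<close>.\<close>
      have "?q f = ?q 0"
        using that by (simp add: q_eq_iff)
      then have "?q (\<phi> f) = ?q (\<phi> 0)"
        using \<psi> by metis
      then show ?thesis
        by (simp add: q_eq_iff \<phi>_zero)
    qed
    then show "\<phi> ` I' \<subseteq> I'"
      by blast
  qed

  have 3: "frobenius_lift p B \<psi>"
    if hom: "\<psi> \<in> Ring.ring_hom B B" and \<psi>: "\<forall>f\<in>carrier Zp2x. \<psi> (?q f) = ?q (\<phi> f)" for \<psi>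
    unfolding frobenius_lift_def
  proof (intro conjI ballI)
    fix b assume "b \<in> carrier B"
    then obtain f where f: "b = ?q f"
      by (auto simp: B_simps)
    obtain c where "\<phi> f = f ^ p + of_nat p * c"
      using \<phi>_eq_power_add by blast
    then have "\<psi> b = b [^]\<^bsub>B\<^esub> p \<oplus>\<^bsub>B\<^esub> [p] \<cdot>\<^bsub>B\<^esub> ?q c"
      using \<psi> unfolding B_def Zp2x_def f
      by (simp add: I'.Quot_simps I'.Quot_nat_pow I'.Quot_add_pow)
    moreover have "?q c \<in> carrier B"
      by (simp add: B_simps)
    ultimately show "\<exists>b'\<in>carrier B. \<psi> b = b [^]\<^bsub>B\<^esub> p \<oplus>\<^bsub>B\<^esub> [p] \<cdot>\<^bsub>B\<^esub> b'"
      by blast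
  qed (rule hom)

  show ?thesis
    using 1 2 3 by blast
qed

end
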